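(* Let $\mathbb X=(X,\tau,\mathsf d,\mathfrak m)$ be an extended metric-topological measure space. Let $b$ be a local Lipschitz derivation on $\mathbb X$. Assume that there exists a function $g\in L^0(\mathfrak m)^+$ such that $$|b(f)|\leq g\,\|f\|_{\mathrm{Lip}_b(X,\tau,\mathsf d)}\quad\mathfrak m\text{-a.e. on }X,\text{ for every }f\in\mathrm{Lip}_b(X,\tau,\mathsf d).$$ Let $C\subseteq X$ be a $\tau$-closed set. Then for any entourage $\mathcal U\in\mathfrak B_{\tau,\mathsf d}$ we have that, for every $f\in\mathrm{Lip}_b(X,\tau,\mathsf d)$, $$|b(f)|(x)\leq g(x)\,\mathrm{Lip}(f,C\cap\mathcal U[x],\mathsf d)\quad\text{for }\mathfrak m\text{-a.e. }x\in C.$$ In particular, if the topology $\tau$ is metrisable on $C$ then, letting $\mathsf d_C=\mathsf d|_{C\times C}$, we have that, for every $f\in\mathrm{Lip}_b(X,\tau,\mathsf d)$, $$|b(f)|\leq g\,\mathrm{lip}_{\mathsf d_C}(f|_C)\quad\mathfrak m\text{-a.e. on }C.$$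
   Context: An extended distance on a set $X$ is a symmetric function $\mathsf d\colon X\times X\to[0,+\infty]$ satisfying the triangle inequality and with $\mathsf d(x,y)=0$ iff $x=y$. For $f\colon X\to\mathbb R$ and $A\subseteq X$, $\mathrm{Lip}(f,A,\mathsf d)=\sup\{|f(x)-f(y)|/\mathsf d(x,y):x,y\in A,\ x\neq y\}$ (with $c/(+\infty)=0$, $\sup\varnothing=0$), $\mathrm{Lip}(f,\mathsf d)=\mathrm{Lip}(f,X,\mathsf d)$. $\mathrm{Lip}_b(X,\tau,\mathsf d)$ is the Banach algebra of bounded $\tau$-continuous $\mathsf d$-Lipschitz functions $f\colon X\to\mathbb R$ with norm $\|f\|_{\mathrm{Lip}_b(X,\tau,\mathsf d)}=\mathrm{Lip}(f,\mathsf d)+\sup_X|f|$. $(X,\tau,\mathsf d)$ is an extended metric-topological space if $\tau$ is Hausdorff, $\mathsf d$ is an extended distance, $\tau$ is the initial topology of $\mathrm{Lip}_b(X,\tau,\mathsf d)$, and $\mathsf d(x,y)=\sup\{|f(x)-f(y)|:f\in\mathrm{Lip}_b(X,\tau,\mathsf d),\ \mathrm{Lip}(f,\mathsf d)\leq 1\}$ for all $x,y$. It becomes an extended metric-topological measure space when equipped with a finite Radon (inner regular with respect to $\tau$-compact sets) measure $\mathfrak m$ on the Borel sets of $\tau$. $L^0(\mathfrak m)$ is the algebra of real-valued $\tau$-Borel functions up to $\mathfrak m$-a.e. equality; $L^0(\mathfrak m)^+$ its nonnegative elements. A Lipschitz derivation on $\mathbb X$ is a linear map $b\colon\mathrm{Lip}_b(X,\tau,\mathsf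 d)\to L^0(\mathfrak m)$ with $b(fg)=f\,b(g)+g\,b(f)$ for all $f,g$. It is local if for every $f\in\mathrm{Lip}_b(X,\tau,\mathsf d)$ one has $b(f)=0$ $\mathfrak m$-a.e. on $\{f=0\}$. Canonical uniformity: $\mathfrak U_{\tau,\mathsf d}$ is the uniform structure on $X$ induced by the family of semidistances $\delta_f(x,y)=|f(x)-f(y)|$, where $f\in\mathrm{Lip}_b(X,\tau,\mathsf d)$ with $\mathrm{Lip}(f,\mathsf d)\leq 1$ (it induces $\tau$). $\mathfrak B_{\tau,\mathsf d}$ is the family of entourages $\mathcal U\in\mathfrak U_{\tau,\mathsf d}$ that are open in the product topology of $X\times X$ and symmetric. For $\mathcal U\in\mathfrak B_{\tau,\mathsf d}$ and $x\in X$, $\mathcal U[x]=\{y\in X:(x,y)\in\mathcal U\}$. Asymptotic slope on $C$: $\mathrm{lip}_{\mathsf d_C}(f|_C)(x)=\inf\{\mathrm{Lip}(f,U\cap C,\mathsf d):x\in U\in\tau\}$ for $x\in C$ (i.e. computed in $C$ with the subspace topology). *)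

theory Defs
  imports "HOL-Analysis.Analysis"
begin

text \<open>
  The underlying set is the type \<open>'a\<close> and its topology is the class operation \<open>open\<close>.
  Extended distances and Lipschitz constants take values in \<open>[0, \<infinity>]\<close>, represented by
  \<^typ>\<open>ennreal\<close>.
\<close>

definition extended_distance :: "('a \<Rightarrow> 'a \<Rightarrow> ennreal) \<Rightarrow> bool" where
  "extended_distance d \<longleftrightarrow>
     (\<forall>x y. d x y = d y x) \<and>
     (\<forall>x y z. d x z \<le> d x y + d y z) \<and>
     (\<forall>x y. d x y = 0 \<longleftrightarrow> x = y)"

text \<open>
  In \<^typ>\<open>ennreal\<close>, \<open>c / \<infinity> = 0\<close> for real \<open>c\<close> and the supremum of the empty set is \<open>0\<close>.
\<close>

definition Lip :: "('a \<Rightarrow> real) \<Rightarrow> 'a set \<Rightarrow> ('a \<Rightarrow> 'a \<Rightarrow> ennreal) \<Rightarrow> ennreal" where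
  "Lip f A d = Sup {ennreal \<bar>f x - f y\<bar> / d x y | x y. x \<in> A \<and> y \<in> A \<and> x \<noteq> y}"

definition Lip_b :: "('a::topological_space \<Rightarrow> 'a \<Rightarrow> ennreal) \<Rightarrow> ('a \<Rightarrow> real) set" where
  "Lip_b d = {f. bounded (range f) \<and> continuous_on UNIV f \<and> Lip f UNIV d < \<infinity>}"

definition Lip_b_norm :: "('a \<Rightarrow> 'a \<Rightarrow> ennreal) \<Rightarrow> ('a \<Rightarrow> real) \<Rightarrow> ennreal" where
  "Lip_b_norm d f = Lip f UNIV d + (SUP x. ennreal \<bar>f x\<bar>)"

definition Lip_b1 :: "('a::topological_space \<Rightarrow> 'a \<Rightarrow> ennreal) \<Rightarrow> ('a \<Rightarrow> real) set" where
  "Lip_b1 d = {f \<in> Lip_b d. Lip f UNIV d \<le> 1}"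

text \<open>
  The second conjunct says that the topology is the initial topology of \<^term>\<open>Lip_b d\<close>; the
  Hausdorff property is imposed by the class.
\<close>

definition extended_metric_topological_space ::
    "('a::t2_space \<Rightarrow> 'a \<Rightarrow> ennreal) \<Rightarrow> bool" where
  "extended_metric_topological_space d \<longleftrightarrow>
     extended_distance d \<and>
     (\<forall>S :: 'a set. open S \<longleftrightarrow> generate_topology {f -` V | f V. f \<in> Lip_b d \<and> open V} S) \<and>
     (\<forall>x y. d x y = (SUP f\<in>Lip_b1 d. ennreal \<bar>f x - f y\<bar>))"

definition finite_Radon_measure :: "'a::topological_space measure \<Rightarrow> bool" where
  "finite_Radon_measure M \<longleftrightarrow>
     finite_measure M \<and> sets M = sets borel \<and>
     (\<forall>B\<in>sets M. emeasure M B = (SUP K\<in>{K. compact K \<and> K \<subseteq> B}. emeasure M K))"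

definition extended_metric_topological_measure_space ::
    "('a::t2_space \<Rightarrow> 'a \<Rightarrow> ennreal) \<Rightarrow> 'a measure \<Rightarrow> bool" where
  "extended_metric_topological_measure_space d M \<longleftrightarrow>
     extended_metric_topological_space d \<and> finite_Radon_measure M"

text \<open>
  Elements of \<open>L\<^sup>0\<close> are given by Borel representatives, so every identity between them is required
  only almost everywhere; the values of \<open>b\<close> outside \<^term>\<open>Lip_b d\<close> are irrelevant.
\<close>

definition Lipschitz_derivation ::
    "('a::topological_space \<Rightarrow> 'a \<Rightarrow> ennreal) \<Rightarrow> 'a measure \<Rightarrow>
     (('a \<Rightarrow> real) \<Rightarrow> ('a \<Rightarrow> real)) \<Rightarrow> bool" where
  "Lipschitz_derivation d M b \<longleftrightarrow>
     (\<forall>f\<in>Lip_b d. b f \<in> borel_measurable M) \<and>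
     (\<forall>f\<in>Lip_b d. \<forall>g\<in>Lip_b d. AE x in M. b (\<lambda>y. f y + g y) x = b f x + b g x) \<and>
     (\<forall>c. \<forall>f\<in>Lip_b d. AE x in M. b (\<lambda>y. c * f y) x = c * b f x) \<and>
     (\<forall>f\<in>Lip_b d. \<forall>g\<in>Lip_b d. AE x in M. b (\<lambda>y. f y * g y) x = f x * b g x + g x * b f x)"

definition local_Lipschitz_derivation ::
    "('a::topological_space \<Rightarrow> 'a \<Rightarrow> ennreal) \<Rightarrow> 'a measure \<Rightarrow>
     (('a \<Rightarrow> real) \<Rightarrow> ('a \<Rightarrow> real)) \<Rightarrow> bool" where
  "local_Lipschitz_derivation d M b \<longleftrightarrow>
     Lipschitz_derivation d M b \<and>
     (\<forall>f\<in>Lip_b d. AE x in M. f x = 0 \<longrightarrow> b f x = 0)"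

text \<open>
  A uniform structure is represented, as in the class \<^class>\<open>uniform_space\<close>, by the filter of its
  entourages.
\<close>

definition canonical_uniformity ::
    "('a::topological_space \<Rightarrow> 'a \<Rightarrow> ennreal) \<Rightarrow> ('a \<times> 'a) filter" where
  "canonical_uniformity d =
     (INF f\<in>Lip_b1 d. INF e\<in>{0<..}. principal {(x, y). \<bar>f x - f y\<bar> < e})"

definition open_sym_entourages ::
    "('a::topological_space \<Rightarrow> 'a \<Rightarrow> ennreal) \<Rightarrow> ('a \<times> 'a) set set" where
  "open_sym_entourages d =
     {U. eventually (\<lambda>p. p \<in> U) (canonical_uniformity d) \<and> open U \<and> sym U}"

text \<open>
  The asymptotic slope of the restriction of \<open>f\<close> to \<open>C\<close>, meaningful for \<open>x \<in> C\<close>: the open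
  neighbourhoods of \<open>x\<close> in the subspace \<open>C\<close> are the sets \<open>U \<inter> C\<close>.
\<close>

definition asymptotic_slope_on ::
    "('a::topological_space \<Rightarrow> 'a \<Rightarrow> ennreal) \<Rightarrow> 'a set \<Rightarrow> ('a \<Rightarrow> real) \<Rightarrow> 'a \<Rightarrow> ennreal" where
  "asymptotic_slope_on d C f x = (INF U\<in>{U. open U \<and> x \<in> U}. Lip f (U \<inter> C) d)"

end

theory Submission
  imports Defs
begin

text \<open>
  Let \<open>K\<close> be compact, \<open>f \<in> Lip_b d\<close> and \<open>L > Lip f K d\<close>. On a piece of \<open>K\<close> where \<open>f\<close> is \<open>e\<close>-close to a
  constant \<open>c\<close>, the function \<open>f - c\<close> agrees with some \<open>F \<in> Lip_b d\<close> with Lipschitz constant \<open>\<le> L\<close> and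
  \<open>\<bar>F\<bar> \<le> e\<close>: the \<open>L\<close>-Lipschitz functions form a lattice which, by the formula for \<open>d\<close>, nearly
  interpolates \<open>f\<close> at any two points of \<open>K\<close>, so a Stone-Weierstrass argument applies. Locality gives
  \<open>\<bar>b f\<bar> = \<bar>b F\<bar> \<le> g (L + e)\<close> there, hence \<open>\<bar>b f\<bar> \<le> g Lip f K d\<close> on \<open>K\<close>, and inner regularity extends
  this to every Borel set. Both claims follow by covering compact subsets of \<open>C\<close> by finitely many
  sufficiently small open sets.
\<close>

section \<open>Bounded continuous functions with a prescribed Lipschitz constant\<close>

text \<open>The constant is a real \<open>L\<close> bounding a product, not a quotient, so it passes
  through lattice operations, sums and pointwise limits without case distinctions on
  \<open>d x y\<close>. For \<open>L > 0\<close> this is the set of \<open>f\<close> in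
  \<open>Lip_b d\<close> with \<open>Lip f UNIV d\<close> at most \<open>L\<close>.\<close>

definition bounded_Lipschitz ::
    "('a::topological_space \<Rightarrow> 'a \<Rightarrow> ennreal) \<Rightarrow> real \<Rightarrow> ('a \<Rightarrow> real) set" where
  "bounded_Lipschitz d L =
     {f. bounded (range f) \<and> continuous_on UNIV f \<and>
         (\<forall>x y. ennreal \<bar>f x - f y\<bar> \<le> ennreal L * d x y)}"

lemma bounded_range_iff: "bounded (range f) \<longleftrightarrow> (\<exists>B. \<forall>x. \<bar>f x :: real\<bar> \<le> B)"
  by (auto simp: bounded_iff)

text \<open>
  The equivalence fails for \<open>L = 0\<close>: a quotient \<open>c / \<infinity>\<close> vanishes, but \<open>c \<le> 0 * \<infinity> = 0\<close> need not
  hold.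
\<close>

lemma Lip_le_iff:
  assumes "extended_distance d" "0 < L"
  shows "Lip f A d \<le> ennreal L \<longleftrightarrow> (\<forall>x\<in>A. \<forall>y\<in>A. ennreal \<bar>f x - f y\<bar> \<le> ennreal L * d x y)"
proof -
  have quot: "ennreal \<bar>f x - f y\<bar> / d x y \<le> ennreal L \<longleftrightarrow> ennreal \<bar>f x - f y\<bar> \<le> ennreal L * d x y"
    if "x \<noteq> y" for x y
  proof (cases "d x y")
    case (real r)
    then have "0 < r"
      using that assms by (metis ennreal_0 extended_distance_def order_le_less)
    then show ?thesis
      using real assms(2) by (simp add: divide_ennreal ennreal_mult[symmetric] field_simps)
  next
    case top
    then show ?thesis
      using assms(2) by (simp add: ennreal_mult_top)
  qed
  have "Lip f A d \<le> ennreal L \<longleftrightarrow>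
      (\<forall>x\<in>A. \<forall>y\<in>A. x \<noteq> y \<longrightarrow> ennreal \<bar>f x - f y\<bar> / d x y \<le> ennreal L)"
    unfolding Lip_def Sup_le_iff by blast
  also have "\<dots> \<longleftrightarrow> (\<forall>x\<in>A. \<forall>y\<in>A. ennreal \<bar>f x - f y\<bar> \<le> ennreal L * d x y)"
    using quot by (metis abs_zero diff_self ennreal_0 zero_le)
  finally show ?thesis .
qed

lemma Lip_mono: "A \<subseteq> B \<Longrightarrow> Lip f A d \<le> Lip f B d"
  unfolding Lip_def by (rule Sup_subset_mono) blast

lemma bounded_Lipschitz_iff:
  assumes "extended_distance d" "0 < L"
  shows "f \<in> bounded_Lipschitz d L \<longleftrightarrow> f \<in> Lip_b d \<and> Lip f UNIV d \<le> ennreal L"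
proof -
  have "Lip f UNIV d < \<infinity>" if "Lip f UNIV d \<le> ennreal L"
    using that by (simp add: le_less_trans)
  then show ?thesis
    unfolding bounded_Lipschitz_def Lip_b_def using Lip_le_iff[OF assms, of f UNIV] by auto
qed

lemma Lip_b_iff:
  assumes "extended_distance d"
  shows "f \<in> Lip_b d \<longleftrightarrow> (\<exists>L>0. f \<in> bounded_Lipschitz d L)"
proof
  assume f: "f \<in> Lip_b d"
  then obtain r where r: "0 \<le> r" "Lip f UNIV d = ennreal r"
    unfolding Lip_b_def by (cases "Lip f UNIV d") auto
  \<comment> \<open>The summand 1 keeps the constant positive when \<open>Lip f UNIV d\<close> is
    0.\<close>
  have "f \<in> bounded_Lipschitz d (r + 1)"
    using f r assms by (simp add: bounded_Lipschitz_iff)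
  then show "\<exists>L>0. f \<in> bounded_Lipschitz d L"
    using r by (intro exI[of _ "r + 1"]) auto
next
  show "\<exists>L>0. f \<in> bounded_Lipschitz d L \<Longrightarrow> f \<in> Lip_b d"
    using assms by (auto simp: bounded_Lipschitz_iff)
qed

lemma bounded_Lipschitz_const: "(\<lambda>_. c) \<in> bounded_Lipschitz d L"
  unfolding bounded_Lipschitz_def by auto

lemma bounded_Lipschitz_max:
  assumes "f \<in> bounded_Lipschitz d L" "g \<in> bounded_Lipschitz d L"
  shows "(\<lambda>x. max (f x) (g x)) \<in> bounded_Lipschitz d L"
proof -
  obtain B B' where B: "\<bar>f x\<bar> \<le> B" "\<bar>g x\<bar> \<le> B'" for x
    using assms unfolding bounded_Lipschitz_def bounded_range_iff by blast
  have "\<bar>max (f x) (g x)\<bar> \<le> max B B'" for x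
    using B[of x] by (auto simp: max_def)
  then have bdd: "bounded (range (\<lambda>x. max (f x) (g x)))"
    unfolding bounded_range_iff by blast
  have "ennreal \<bar>max (f x) (g x) - max (f y) (g y)\<bar> \<le> ennreal L * d x y" for x y
  proof -
    have "\<bar>max (f x) (g x) - max (f y) (g y)\<bar> \<le> max \<bar>f x - f y\<bar> \<bar>g x - g y\<bar>"
      by (auto simp: max_def)
    then have "ennreal \<bar>max (f x) (g x) - max (f y) (g y)\<bar> \<le> ennreal (max \<bar>f x - f y\<bar> \<bar>g x - g y\<bar>)"
      by (rule ennreal_leI)
    also have "\<dots> \<le> ennreal L * d x y"
      using assms unfolding bounded_Lipschitz_def by (auto simp: max_def)
    finally show ?thesis .
  qed
  then show ?thesis
    using assms bdd unfolding bounded_Lipschitz_def by (auto intro: continuous_on_max)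
qed

lemma bounded_Lipschitz_scale:
  assumes "f \<in> bounded_Lipschitz d L"
  shows "(\<lambda>x. c * f x) \<in> bounded_Lipschitz d (\<bar>c\<bar> * L)"
proof -
  obtain B where B: "\<bar>f x\<bar> \<le> B" for x
    using assms unfolding bounded_Lipschitz_def bounded_range_iff by blast
  have "\<bar>c * f x\<bar> \<le> \<bar>c\<bar> * B" for x
    using B[of x] by (simp add: abs_mult mult_left_mono)
  then have bdd: "bounded (range (\<lambda>x. c * f x))"
    unfolding bounded_range_iff by blast
  have "ennreal \<bar>c * f x - c * f y\<bar> \<le> ennreal (\<bar>c\<bar> * L) * d x y" for x y
  proof -
    have "ennreal \<bar>c * f x - c * f y\<bar> = ennreal \<bar>c\<bar> * ennreal \<bar>f x - f y\<bar>"
      by (simp add: abs_mult ennreal_mult[symmetric] flip: right_diff_distrib)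
    also have "\<dots> \<le> ennreal \<bar>c\<bar> * (ennreal L * d x y)"
      using assms unfolding bounded_Lipschitz_def by (intro mult_left_mono) auto
    also have "\<dots> = ennreal (\<bar>c\<bar> * L) * d x y"
      by (simp add: ennreal_mult' mult.assoc)
    finally show ?thesis .
  qed
  then show ?thesis
    using assms bdd unfolding bounded_Lipschitz_def by (auto intro: continuous_intros)
qed

lemma bounded_Lipschitz_min:
  assumes "f \<in> bounded_Lipschitz d L" "g \<in> bounded_Lipschitz d L"
  shows "(\<lambda>x. min (f x) (g x)) \<in> bounded_Lipschitz d L"
proof -
  have "(\<lambda>x. - 1 * max (- 1 * f x) (- 1 * g x)) \<in> bounded_Lipschitz d L"
    using bounded_Lipschitz_scale[OF bounded_Lipschitz_max[OF
        bounded_Lipschitz_scale[OF assms(1), of "-1"] bounded_Lipschitz_scale[OF assms(2), of "-1"]],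
        of "-1"] by simp
  then show ?thesis
    by (simp add: minus_max_eq_min)
qed

lemma bounded_Lipschitz_add:
  assumes "f \<in> bounded_Lipschitz d L" "g \<in> bounded_Lipschitz d L'" "0 \<le> L" "0 \<le> L'"
  shows "(\<lambda>x. f x + g x) \<in> bounded_Lipschitz d (L + L')"
proof -
  obtain B B' where B: "\<bar>f x\<bar> \<le> B" "\<bar>g x\<bar> \<le> B'" for x
    using assms unfolding bounded_Lipschitz_def bounded_range_iff by blast
  have "\<bar>f x + g x\<bar> \<le> B + B'" for x
    using B[of x] by auto
  then have bdd: "bounded (range (\<lambda>x. f x + g x))"
    unfolding bounded_range_iff by blast
  have "ennreal \<bar>f x + g x - (f y + g y)\<bar> \<le> ennreal (L + L') * d x y" for x y
  proof -
    have "ennreal \<bar>f x + g x - (f y + g y)\<bar> \<le> ennreal (\<bar>f x - f y\<bar> + \<bar>g x - g y\<bar>)"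
      by (rule ennreal_leI) auto
    also have "\<dots> = ennreal \<bar>f x - f y\<bar> + ennreal \<bar>g x - g y\<bar>"
      by simp
    also have "\<dots> \<le> ennreal L * d x y + ennreal L' * d x y"
      using assms unfolding bounded_Lipschitz_def by (intro add_mono) auto
    also have "\<dots> = ennreal (L + L') * d x y"
      using assms by (simp add: distrib_right)
    finally show ?thesis .
  qed
  then show ?thesis
    using assms bdd unfolding bounded_Lipschitz_def by (auto intro: continuous_intros)
qed

lemma bounded_Lipschitz_add_const:
  assumes "f \<in> bounded_Lipschitz d L" "0 \<le> L"
  shows "(\<lambda>x. f x + c) \<in> bounded_Lipschitz d L"
  using bounded_Lipschitz_add[OF assms(1) bounded_Lipschitz_const[of c d 0]] assms(2) by simp

lemma Lip_b_const: "extended_distance d \<Longrightarrow> (\<lambda>_. c) \<in> Lip_b d"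
  using bounded_Lipschitz_const[of c d 1] Lip_b_iff zero_less_one by blast

lemma Lip_b_add:
  assumes "extended_distance d" "f \<in> Lip_b d" "g \<in> Lip_b d"
  shows "(\<lambda>x. f x + g x) \<in> Lip_b d"
proof -
  obtain L L' where "0 < L" "f \<in> bounded_Lipschitz d L" "0 < L'" "g \<in> bounded_Lipschitz d L'"
    using assms Lip_b_iff by blast
  then have "0 < L + L'" "(\<lambda>x. f x + g x) \<in> bounded_Lipschitz d (L + L')"
    by (auto intro: bounded_Lipschitz_add)
  then show ?thesis
    using assms(1) Lip_b_iff by blast
qed

lemma Lip_b_scale:
  assumes "extended_distance d" "f \<in> Lip_b d"
  shows "(\<lambda>x. c * f x) \<in> Lip_b d"
proof (cases "c = 0")
  case True
  then show ?thesis
    using Lip_b_const[OF assms(1), of 0] by simp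
next
  case False
  obtain L where "0 < L" "f \<in> bounded_Lipschitz d L"
    using assms Lip_b_iff by blast
  then have "0 < \<bar>c\<bar> * L" "(\<lambda>x. c * f x) \<in> bounded_Lipschitz d (\<bar>c\<bar> * L)"
    using False bounded_Lipschitz_scale by auto
  then show ?thesis
    using assms(1) Lip_b_iff by blast
qed

text \<open>The compactness arguments below use an upper envelope in two ways: it dominates every
  \<open>f i\<close>, and at each point it equals one of them, so it inherits any upper bound common
  to all.\<close>

lemma bounded_Lipschitz_finite_max:
  assumes "finite I" "I \<noteq> {}" "\<And>i. i \<in> I \<Longrightarrow> f i \<in> bounded_Lipschitz d L"
  shows "\<exists>F\<in>bounded_Lipschitz d L. \<forall>x. (\<forall>i\<in>I. f i x \<le> F x) \<and> (\<exists>i\<in>I. F x = f i x)"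
  using assms
proof (induction rule: finite_ne_induct)
  case (insert i I)
  then obtain F where F: "F \<in> bounded_Lipschitz d L"
    "\<And>x. (\<forall>i\<in>I. f i x \<le> F x) \<and> (\<exists>i\<in>I. F x = f i x)"
    by blast
  show ?case
  proof (rule bexI[where x = "\<lambda>x. max (f i x) (F x)"])
    show "(\<lambda>x. max (f i x) (F x)) \<in> bounded_Lipschitz d L"
      using F insert.prems by (intro bounded_Lipschitz_max) auto
    show "\<forall>x. (\<forall>j\<in>insert i I. f j x \<le> max (f i x) (F x)) \<and>
        (\<exists>j\<in>insert i I. max (f i x) (F x) = f j x)"
      using F(2) by (fastforce simp: max_def)
  qed
qed auto

lemma bounded_Lipschitz_finite_min:
  assumes "finite I" "I \<noteq> {}" "\<And>i. i \<in> I \<Longrightarrow> f i \<in> bounded_Lipschitz d L"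
  shows "\<exists>F\<in>bounded_Lipschitz d L. \<forall>x. (\<forall>i\<in>I. F x \<le> f i x) \<and> (\<exists>i\<in>I. F x = f i x)"
proof -
  have "\<And>i. i \<in> I \<Longrightarrow> (\<lambda>x. - 1 * f i x) \<in> bounded_Lipschitz d L"
    using bounded_Lipschitz_scale[of _ d L "-1"] assms(3) by force
  from bounded_Lipschitz_finite_max[where f = "\<lambda>i x. - 1 * f i x", OF assms(1,2) this] obtain F
    where F: "F \<in> bounded_Lipschitz d L"
      "\<forall>x. (\<forall>i\<in>I. - 1 * f i x \<le> F x) \<and> (\<exists>i\<in>I. F x = - 1 * f i x)"
    by blast
  have "(\<lambda>x. - 1 * F x) \<in> bounded_Lipschitz d L"
    using bounded_Lipschitz_scale[OF F(1), of "-1"] by simp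
  moreover have "(\<forall>i\<in>I. - 1 * F x \<le> f i x) \<and> (\<exists>i\<in>I. - 1 * F x = f i x)" for x
    using F(2)[rule_format, of x] by fastforce
  ultimately show ?thesis
    by (intro bexI[where x = "\<lambda>x. - 1 * F x"]) blast+
qed

section \<open>Approximation and extension from compact sets\<close>

text \<open>The supremum formula for \<open>d\<close> supplies a 1-Lipschitz \<open>u\<close> whose
  increment between \<open>x\<close> and \<open>y\<close> is large enough. Multiplying
  \<open>u\<close> by \<open>L\<close> or \<open>- L\<close> and shifting it to the value
  \<open>f y\<close> at \<open>y\<close> gives \<open>h\<close>. When \<open>f x - e < f y\<close>,
  a constant already suffices.\<close>

lemma bounded_Lipschitz_separate:
  assumes "extended_metric_topological_space d" "0 < L" "0 < e"
    and "ennreal \<bar>f x - f y\<bar> \<le> ennreal L * d x y"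
  shows "\<exists>h\<in>bounded_Lipschitz d L. f x - e < h x \<and> h y < f y + e"
proof (cases "f x - e < f y")
  case True
  then show ?thesis
    using \<open>0 < e\<close> by (intro bexI[where x = "\<lambda>_. f y"] bounded_Lipschitz_const) auto
next
  case False
  have dist: "extended_distance d" and
    sup: "d x y = (SUP u\<in>Lip_b1 d. ennreal \<bar>u x - u y\<bar>)"
    using assms(1) unfolding extended_metric_topological_space_def by auto
  \<comment> \<open>The increment required of \<open>u\<close>: \<open>L * t\<close> falls short of
    \<open>\<bar>f x - f y\<bar>\<close> by exactly \<open>e\<close>. This slack makes
    \<open>t < d x y\<close> strict, as needed to pick \<open>u\<close> from the supremum.\<close>
  define t where "t = (f x - f y - e) / L"
  have t: "0 \<le> t"
    using False \<open>0 < L\<close> by (simp add: t_def)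
  have "L * t < \<bar>f x - f y\<bar>"
    using \<open>0 < e\<close> \<open>0 < L\<close> by (simp add: t_def)
  then have "ennreal (L * t) < ennreal \<bar>f x - f y\<bar>"
    using \<open>0 < L\<close> t by (simp add: ennreal_less_iff)
  also note assms(4)
  finally have "ennreal L * ennreal t < ennreal L * d x y"
    using \<open>0 < L\<close> t by (simp add: ennreal_mult)
  then have "ennreal t < d x y"
    by (meson linorder_not_le mult_left_mono zero_le)
  then obtain u where u: "u \<in> Lip_b1 d" "ennreal t < ennreal \<bar>u x - u y\<bar>"
    unfolding sup less_SUP_iff by blast
  have "u \<in> bounded_Lipschitz d 1"
    using u(1) dist by (simp add: Lip_b1_def bounded_Lipschitz_iff)
  \<comment> \<open>The sign turns \<open>s * (u x - u y)\<close> into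
    \<open>L * \<bar>u x - u y\<bar>\<close>.\<close>
  moreover define s where "s = (if u y \<le> u x then L else - L)"
  ultimately have h: "(\<lambda>z. s * u z + (f y - s * u y)) \<in> bounded_Lipschitz d L"
    using bounded_Lipschitz_scale[of u d 1 s] \<open>0 < L\<close>
    by (intro bounded_Lipschitz_add_const) (auto simp: s_def split: if_splits)
  have "t < \<bar>u x - u y\<bar>"
    using u(2) t by (simp add: ennreal_less_iff)
  then have "f x - f y - e < L * \<bar>u x - u y\<bar>"
    using \<open>0 < L\<close> by (simp add: t_def pos_divide_less_eq mult.commute)
  also have "\<dots> = s * u x - s * u y"
    by (auto simp: s_def algebra_simps abs_if)
  finally show ?thesis
    using h \<open>0 < e\<close> by (intro bexI[OF _ h]) auto
qed

text \<open>Compactness is used twice. For fixed \<open>x\<close>, a finite minimum of functions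
  separating \<open>x\<close> from points \<open>y\<close> lies below \<open>f + e\<close> on all of
  \<open>K\<close> and still exceeds \<open>f x - e\<close> at \<open>x\<close>. A finite maximum of
  these minima over points \<open>x\<close> then exceeds \<open>f - e\<close> on \<open>K\<close>,
  and stays below \<open>f + e\<close> because each of them does.\<close>

lemma bounded_Lipschitz_approx:
  assumes emts: "extended_metric_topological_space d" and "0 < L" "0 < e"
    and K: "compact K" and f: "continuous_on UNIV f"
    and fL: "\<And>x y. x \<in> K \<Longrightarrow> y \<in> K \<Longrightarrow> ennreal \<bar>f x - f y\<bar> \<le> ennreal L * d x y"
  shows "\<exists>h\<in>bounded_Lipschitz d L. \<forall>x\<in>K. \<bar>h x - f x\<bar> < e"
proof (cases "K = {}")
  case True
  then show ?thesis
    using bounded_Lipschitz_const[of 0 d L] by auto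
next
  case False
  have cont: "continuous_on UNIV h" if "h \<in> bounded_Lipschitz d L" for h
    using that by (simp add: bounded_Lipschitz_def)
  have "\<exists>h\<in>bounded_Lipschitz d L. f x - e < h x \<and> (\<forall>y\<in>K. h y < f y + e)"
    if "x \<in> K" for x
  proof -
    have "\<forall>y\<in>K. \<exists>h\<in>bounded_Lipschitz d L. f x - e < h x \<and> h y < f y + e"
      using that by (intro ballI bounded_Lipschitz_separate assms) auto
    then obtain h where h: "\<And>y. y \<in> K \<Longrightarrow> h y \<in> bounded_Lipschitz d L"
      "\<And>y. y \<in> K \<Longrightarrow> f x - e < h y x" "\<And>y. y \<in> K \<Longrightarrow> h y y < f y + e"
      by metis
    obtain I where I: "I \<subseteq> K" "finite I" "K \<subseteq> (\<Union>y\<in>I. {z. h y z < f z + e})"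
    proof (rule compactE_image[OF K, of K "\<lambda>y. {z. h y z < f z + e}"])
      show "open {z. h y z < f z + e}" if "y \<in> K" for y
        by (intro open_Collect_less continuous_intros f cont h that)
    qed (use h in auto)
    then have "I \<noteq> {}"
      using False by auto
    with I h(1) obtain F where F: "F \<in> bounded_Lipschitz d L"
      "\<And>z. (\<forall>y\<in>I. F z \<le> h y z) \<and> (\<exists>y\<in>I. F z = h y z)"
      using bounded_Lipschitz_finite_min[of I h d L] by blast
    have "F z < f z + e" if z: "z \<in> K" for z
    proof -
      obtain y where "y \<in> I" "h y z < f z + e"
        using I(3) z by blast
      then show ?thesis
        using F(2)[of z] by force
    qed
    moreover have "f x - e < F x"
      using F(2)[of x] h(2) I(1) by force
    ultimately show ?thesis
      using F(1) by blast
  qed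
  then obtain h where h: "\<And>x. x \<in> K \<Longrightarrow> h x \<in> bounded_Lipschitz d L"
    "\<And>x. x \<in> K \<Longrightarrow> f x - e < h x x" "\<And>x y. x \<in> K \<Longrightarrow> y \<in> K \<Longrightarrow> h x y < f y + e"
    by metis
  obtain I where I: "I \<subseteq> K" "finite I" "K \<subseteq> (\<Union>x\<in>I. {z. f z - e < h x z})"
  proof (rule compactE_image[OF K, of K "\<lambda>x. {z. f z - e < h x z}"])
    show "open {z. f z - e < h x z}" if "x \<in> K" for x
      by (intro open_Collect_less continuous_intros f cont h that)
  qed (use h in auto)
  then have "I \<noteq> {}"
    using False by auto
  with I h(1) obtain F where F: "F \<in> bounded_Lipschitz d L"
    "\<And>z. (\<forall>x\<in>I. h x z \<le> F z) \<and> (\<exists>x\<in>I. F z = h x z)"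
    using bounded_Lipschitz_finite_max[of I h d L] by blast
  have "\<bar>F z - f z\<bar> < e" if z: "z \<in> K" for z
  proof -
    obtain x where "x \<in> I" "f z - e < h x z"
      using I(3) z by blast
    then have "f z - e < F z"
      using F(2)[of z] by force
    moreover have "F z < f z + e"
      using F(2)[of z] h(3) I(1) z by force
    ultimately show ?thesis
      by auto
  qed
  then show ?thesis
    using F(1) by blast
qed

text \<open>
  Truncating each approximant to a shrinking band around its predecessor makes the approximants
  converge uniformly on the whole space, without increasing the Lipschitz constant.
\<close>

lemma bounded_Lipschitz_extension:
  assumes emts: "extended_metric_topological_space d" and "0 < L" "0 \<le> e"
    and K: "compact K" and f: "continuous_on UNIV f"
    and fL: "\<And>x y. x \<in> K \<Longrightarrow> y \<in> K \<Longrightarrow> ennreal \<bar>f x - f y\<bar> \<le> ennreal L * d x y"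
    and fe: "\<And>x. x \<in> K \<Longrightarrow> \<bar>f x\<bar> \<le> e"
  shows "\<exists>F\<in>bounded_Lipschitz d L. (\<forall>x\<in>K. F x = f x) \<and> (\<forall>x. \<bar>F x\<bar> \<le> e)"
proof -
  have approx: "\<exists>h\<in>bounded_Lipschitz d L. \<forall>x\<in>K. \<bar>h x - f x\<bar> \<le> (1/2)^n" for n :: nat
  proof -
    have "\<exists>h\<in>bounded_Lipschitz d L. \<forall>x\<in>K. \<bar>h x - f x\<bar> < (1/2)^n"
      by (rule bounded_Lipschitz_approx[OF emts \<open>0 < L\<close> _ K f fL]) auto
    then show ?thesis
      by (meson less_imp_le)
  qed
  have "\<exists>h. \<forall>n. (h n \<in> bounded_Lipschitz d L \<and> (\<forall>x\<in>K. \<bar>h n x - f x\<bar> \<le> (1/2)^n)) \<and>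
      (\<forall>x. \<bar>h (Suc n) x - h n x\<bar> \<le> 2 * (1/2)^n)"
  proof (rule dependent_nat_choice)
    show "\<exists>h. h \<in> bounded_Lipschitz d L \<and> (\<forall>x\<in>K. \<bar>h x - f x\<bar> \<le> (1/2)^0)"
      using approx by blast
  next
    fix h and n :: nat
    assume h: "h \<in> bounded_Lipschitz d L \<and> (\<forall>x\<in>K. \<bar>h x - f x\<bar> \<le> (1/2)^n)"
    define r :: real where "r = (1/2)^n"
    have r: "0 < r" "(1/2)^Suc n = r / 2"
      by (auto simp: r_def)
    obtain u where u: "u \<in> bounded_Lipschitz d L" "\<forall>x\<in>K. \<bar>u x - f x\<bar> \<le> (1/2)^Suc n"
      using approx by blast
    \<comment> \<open>On \<open>K\<close> the truncation is inactive: there \<open>u\<close> and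
      \<open>h\<close> differ by at most \<open>r / 2 + r\<close>, which is less than
      \<open>2 * r\<close>. Off \<open>K\<close> it forces \<open>v\<close> to stay within
      \<open>2 * r\<close> of \<open>h\<close>.\<close>
    define v where "v = (\<lambda>x. min (max (u x) (h x + - (2 * r))) (h x + 2 * r))"
    have "v \<in> bounded_Lipschitz d L"
      unfolding v_def using u h \<open>0 < L\<close>
      by (intro bounded_Lipschitz_min bounded_Lipschitz_max bounded_Lipschitz_add_const) auto
    moreover have "\<bar>v x - f x\<bar> \<le> (1/2)^Suc n" if "x \<in> K" for x
    proof -
      have "\<bar>u x - f x\<bar> \<le> r / 2" "\<bar>h x - f x\<bar> \<le> r"
        using u(2) h that r(2) by (auto simp: r_def)
      then have "v x = u x"
        using r(1) unfolding v_def by linarith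
      then show ?thesis
        using u(2) that by simp
    qed
    moreover have "\<bar>v x - h x\<bar> \<le> 2 * (1/2)^n" for x
      using r(1) unfolding v_def r_def[symmetric] by linarith
    ultimately show "\<exists>v. (v \<in> bounded_Lipschitz d L \<and> (\<forall>x\<in>K. \<bar>v x - f x\<bar> \<le> (1/2)^Suc n)) \<and>
        (\<forall>x. \<bar>v x - h x\<bar> \<le> 2 * (1/2)^n)"
      by blast
  qed
  then obtain h where h: "\<And>n. h n \<in> bounded_Lipschitz d L"
    "\<And>n x. x \<in> K \<Longrightarrow> \<bar>h n x - f x\<bar> \<le> (1/2)^n"
    "\<And>n x. \<bar>h (Suc n) x - h n x\<bar> \<le> 2 * (1/2)^n"
    by blast
  \<comment> \<open>The right-hand side is the exact geometric sum of the step bounds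
    \<open>2 * (1/2)^j\<close> for \<open>j\<close> from \<open>n\<close> to
    \<open>n + k - 1\<close>; keeping the subtracted term lets the induction close.\<close>
  have tele: "\<bar>h (n + k) x - h n x\<bar> \<le> 4 * (1/2)^n - 4 * (1/2)^(n + k)" for n k x
  proof (induction k)
    case (Suc k)
    then show ?case
      using h(3)[of "n + k" x] by auto
  qed simp
  have tele': "\<bar>h m x - h n x\<bar> \<le> 4 * (1/2)^n" if "n \<le> m" for m n x
  proof -
    have "4 * (1/2)^n - 4 * (1/2)^m \<le> 4 * (1/2::real)^n"
      by simp
    moreover have "\<bar>h m x - h n x\<bar> \<le> 4 * (1/2)^n - 4 * (1/2)^m"
      using tele[of n "m - n" x] that by simp
    ultimately show ?thesis
      by (rule order_trans[rotated])
  qed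
  have null: "(\<lambda>n. 4 * (1/2::real)^n) \<longlonglongrightarrow> 0"
    by (intro tendsto_mult_right_zero LIMSEQ_realpow_zero) auto
  have "uniformly_Cauchy_on UNIV h"
  proof (rule uniformly_Cauchy_onI')
    fix e :: real assume "0 < e"
    then obtain N where N: "4 * (1/2::real)^N < e / 2"
      using order_tendstoD(2)[OF null, of "e / 2"] by (auto simp: eventually_sequentially)
    have "dist (h m x) (h n x) < e" if "m \<ge> N" "n > m" for m n x
      using tele'[of N m x] tele'[of N n x] that N by (auto simp: dist_real_def)
    then show "\<exists>N. \<forall>x\<in>UNIV. \<forall>m\<ge>N. \<forall>n>m. dist (h m x) (h n x) < e"
      by blast
  qed
  then obtain F where F: "uniform_limit UNIV h F sequentially"
    using Cauchy_uniformly_convergent uniformly_convergent_on_def by blast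
  have lim: "(\<lambda>n. h n x) \<longlonglongrightarrow> F x" for x
    using tendsto_uniform_limitI[OF F] by simp
  have "continuous_on UNIV F"
    by (rule uniform_limit_theorem[OF _ F]) (use h(1) in \<open>auto simp: bounded_Lipschitz_def\<close>)
  moreover have "bounded (range F)"
  proof -
    obtain B where B: "\<bar>h 0 x\<bar> \<le> B" for x
      using h(1)[of 0] unfolding bounded_Lipschitz_def bounded_range_iff by blast
    have "\<bar>h n x\<bar> \<le> B + 4" for n x
      using B[of x] tele'[of 0 n x] by auto
    then have "\<bar>F x\<bar> \<le> B + 4" for x
      by (intro LIMSEQ_le_const2[OF tendsto_rabs[OF lim]]) blast
    then show ?thesis
      unfolding bounded_range_iff by blast
  qed
  moreover have "ennreal \<bar>F x - F y\<bar> \<le> ennreal L * d x y" for x y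
  proof (rule LIMSEQ_le_const2)
    show "(\<lambda>n. ennreal \<bar>h n x - h n y\<bar>) \<longlonglongrightarrow> ennreal \<bar>F x - F y\<bar>"
      by (intro tendsto_intros lim)
    show "\<exists>N. \<forall>n\<ge>N. ennreal \<bar>h n x - h n y\<bar> \<le> ennreal L * d x y"
      using h(1) by (auto simp: bounded_Lipschitz_def)
  qed
  ultimately have FL: "F \<in> bounded_Lipschitz d L"
    by (simp add: bounded_Lipschitz_def)
  have Ff: "F x = f x" if "x \<in> K" for x
  proof (rule LIMSEQ_unique[OF lim])
    have "(\<lambda>n. (1/2::real)^n) \<longlonglongrightarrow> 0"
      by (intro LIMSEQ_realpow_zero) auto
    then have "(\<lambda>n. h n x - f x) \<longlonglongrightarrow> 0"
      by (rule Lim_null_comparison[rotated]) (use h(2)[OF that] in auto)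
    then show "(\<lambda>n. h n x) \<longlonglongrightarrow> f x"
      by (simp add: LIM_zero_iff)
  qed
  \<comment> \<open>Clipping the limit to the interval from \<open>- e\<close> to \<open>e\<close>
    preserves its values on \<open>K\<close>, where \<open>\<bar>f x\<bar> \<le> e\<close>.\<close>
  show ?thesis
  proof (intro bexI conjI)
    show "(\<lambda>x. min (max (F x) (- e)) e) \<in> bounded_Lipschitz d L"
      by (intro bounded_Lipschitz_min bounded_Lipschitz_max bounded_Lipschitz_const FL)
    show "\<forall>x\<in>K. min (max (F x) (- e)) e = f x"
      using Ff fe by fastforce
    show "\<forall>x. \<bar>min (max (F x) (- e)) e\<bar> \<le> e"
      using \<open>0 \<le> e\<close> by auto
  qed
qed

section \<open>Local derivations and their bound on compact sets\<close>

text \<open>Locality is applied to the difference of \<open>f\<close> and \<open>h\<close>, written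
  as a sum with \<open>- 1 * h\<close> so that additivity and homogeneity of \<open>b\<close> split
  it.\<close>

lemma local_Lipschitz_derivation_cong:
  assumes "extended_distance d" "local_Lipschitz_derivation d M b" "f \<in> Lip_b d" "h \<in> Lip_b d"
  shows "AE x in M. f x = h x \<longrightarrow> b f x = b h x"
proof -
  define h' where "h' = (\<lambda>x. - 1 * h x)"
  have h': "h' \<in> Lip_b d"
    unfolding h'_def using assms by (intro Lip_b_scale)
  have "AE x in M. u x = 0 \<longrightarrow> b u x = 0" if "u \<in> Lip_b d" for u
    using assms(2) that unfolding local_Lipschitz_derivation_def by blast
  from this[OF Lip_b_add[OF assms(1,3) h']]
  have "AE x in M. f x + h' x = 0 \<longrightarrow> b (\<lambda>x. f x + h' x) x = 0" .
  moreover have "AE x in M. b (\<lambda>x. f x + h' x) x = b f x + b h' x"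
    using assms h' unfolding local_Lipschitz_derivation_def Lipschitz_derivation_def by blast
  moreover have "AE x in M. b h' x = - 1 * b h x"
    unfolding h'_def
    using assms unfolding local_Lipschitz_derivation_def Lipschitz_derivation_def by blast
  ultimately show ?thesis
    by eventually_elim (auto simp: h'_def)
qed

text \<open>The Leibniz rule for \<open>1 * 1\<close> makes \<open>b\<close> of the constant 1 equal
  to twice itself, hence 0; homogeneity handles the other constants.\<close>

lemma Lipschitz_derivation_const:
  assumes "extended_distance d" "Lipschitz_derivation d M b"
  shows "AE x in M. b (\<lambda>_. c) x = 0"
proof -
  have one: "(\<lambda>_. 1) \<in> Lip_b d"
    using assms(1) by (rule Lip_b_const)
  then have "AE x in M. b (\<lambda>_. 1 * 1) x = 1 * b (\<lambda>_. 1) x + 1 * b (\<lambda>_. 1) x"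
    using assms(2) unfolding Lipschitz_derivation_def by fast
  moreover have "AE x in M. b (\<lambda>_. c * 1) x = c * b (\<lambda>_. 1) x"
    using assms(2) one unfolding Lipschitz_derivation_def by fast
  ultimately show ?thesis
    by eventually_elim simp
qed

lemma Lipschitz_derivation_add_const:
  assumes "extended_distance d" "Lipschitz_derivation d M b" "f \<in> Lip_b d"
  shows "AE x in M. b (\<lambda>y. f y + c) x = b f x"
proof -
  have "AE x in M. b (\<lambda>y. f y + c) x = b f x + b (\<lambda>_. c) x"
    using assms(2,3) Lip_b_const[OF assms(1), of c] unfolding Lipschitz_derivation_def by fast
  then show ?thesis
    using Lipschitz_derivation_const[OF assms(1,2), of c] by eventually_elim simp
qed

lemma derivation_le_on_compact_approx:
  fixes d :: "'a::t2_space \<Rightarrow> 'a \<Rightarrow> ennreal"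
  assumes emts: "extended_metric_topological_space d"
    and b: "local_Lipschitz_derivation d M b"
    and bound: "\<And>f. f \<in> Lip_b d \<Longrightarrow> AE x in M. ennreal \<bar>b f x\<bar> \<le> ennreal (g x) * Lip_b_norm d f"
    and K: "compact K" and f: "f \<in> Lip_b d"
    and L: "0 < L" "Lip f K d \<le> ennreal L" and "0 < e"
  shows "AE x in M. x \<in> K \<longrightarrow> ennreal \<bar>b f x\<bar> \<le> ennreal (g x) * ennreal (L + e)"
proof -
  have dist: "extended_distance d"
    using emts unfolding extended_metric_topological_space_def by blast
  have cont: "continuous_on UNIV f"
    using f by (simp add: Lip_b_def)
  \<comment> \<open>Since \<open>b\<close> ignores the added constant, the supremum part of the norm
    only has to account for the size of \<open>f + c\<close> on the piece, which is at most
    \<open>e\<close>, rather than for the size of \<open>f\<close>.\<close>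
  have piece: "AE x in M. x \<in> K \<and> \<bar>f x + c\<bar> \<le> e \<longrightarrow>
      ennreal \<bar>b f x\<bar> \<le> ennreal (g x) * ennreal (L + e)" for c
  proof -
    define K' where "K' = K \<inter> {x. \<bar>f x + c\<bar> \<le> e}"
    have K': "compact K'"
      unfolding K'_def
      by (intro compact_Int_closed K closed_Collect_le continuous_intros cont)
    have "\<exists>F\<in>bounded_Lipschitz d L. (\<forall>x\<in>K'. F x = f x + c) \<and> (\<forall>x. \<bar>F x\<bar> \<le> e)"
    proof (rule bounded_Lipschitz_extension[OF emts \<open>0 < L\<close> _ K'])
      show "ennreal \<bar>f x + c - (f y + c)\<bar> \<le> ennreal L * d x y" if "x \<in> K'" "y \<in> K'" for x y
        using L that unfolding Lip_le_iff[OF dist L(1)] K'_def by simp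
    qed (use \<open>0 < e\<close> in \<open>auto simp: K'_def intro!: continuous_intros cont\<close>)
    then obtain F where F: "F \<in> bounded_Lipschitz d L" "\<And>x. x \<in> K' \<Longrightarrow> F x = f x + c"
      "\<And>x. \<bar>F x\<bar> \<le> e"
      by blast
    then have F_Lip: "F \<in> Lip_b d" "Lip F UNIV d \<le> ennreal L"
      using bounded_Lipschitz_iff[OF dist L(1)] by auto
    have "Lip_b_norm d F \<le> ennreal L + ennreal e"
      unfolding Lip_b_norm_def using F(3) by (intro add_mono F_Lip SUP_least ennreal_leI)
    then have norm: "Lip_b_norm d F \<le> ennreal (L + e)"
      using L(1) \<open>0 < e\<close> by simp
    have fc: "(\<lambda>x. f x + c) \<in> Lip_b d"
      using Lip_b_add[OF dist f Lip_b_const[OF dist]] .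
    have "AE x in M. b (\<lambda>y. f y + c) x = b f x"
      using dist b f unfolding local_Lipschitz_derivation_def
      by (intro Lipschitz_derivation_add_const[of d]) auto
    with local_Lipschitz_derivation_cong[OF dist b F_Lip(1) fc] bound[OF F_Lip(1)]
    show ?thesis
    proof eventually_elim
      case (elim x)
      show ?case
      proof
        assume "x \<in> K \<and> \<bar>f x + c\<bar> \<le> e"
        then have "b f x = b F x"
          using elim F(2)[of x] by (simp add: K'_def)
        then have "ennreal \<bar>b f x\<bar> \<le> ennreal (g x) * Lip_b_norm d F"
          using elim by simp
        also have "\<dots> \<le> ennreal (g x) * ennreal (L + e)"
          by (intro mult_left_mono norm) auto
        finally show "ennreal \<bar>b f x\<bar> \<le> ennreal (g x) * ennreal (L + e)" .
      qed
    qed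
  qed
  \<comment> \<open>Shifts by integer multiples of \<open>e\<close> suffice, because the floor of
    \<open>f x / e\<close> leaves a remainder in \<open>[0, e)\<close>. There are countably many, so
    the exceptional null sets can be merged.\<close>
  have "AE x in M. \<forall>k::int. x \<in> K \<and> \<bar>f x + - (of_int k * e)\<bar> \<le> e \<longrightarrow>
      ennreal \<bar>b f x\<bar> \<le> ennreal (g x) * ennreal (L + e)"
    unfolding AE_all_countable using piece by blast
  then show ?thesis
  proof eventually_elim
    case (elim x)
    define k where "k = \<lfloor>f x / e\<rfloor>"
    have "of_int k * e \<le> f x" "f x < (of_int k + 1) * e"
      using \<open>0 < e\<close> unfolding k_def by (simp_all add: floor_divide_lower floor_divide_upper)
    then have "\<bar>f x + - (of_int k * e)\<bar> \<le> e"
      by (simp add: algebra_simps)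
    then show ?case
      using elim by blast
  qed
qed

lemma derivation_le_on_compact:
  fixes d :: "'a::t2_space \<Rightarrow> 'a \<Rightarrow> ennreal"
  assumes emts: "extended_metric_topological_space d"
    and b: "local_Lipschitz_derivation d M b"
    and bound: "\<And>f. f \<in> Lip_b d \<Longrightarrow> AE x in M. ennreal \<bar>b f x\<bar> \<le> ennreal (g x) * Lip_b_norm d f"
    and K: "compact K" and f: "f \<in> Lip_b d"
  shows "AE x in M. x \<in> K \<longrightarrow> ennreal \<bar>b f x\<bar> \<le> ennreal (g x) * Lip f K d"
proof -
  have "Lip f K d < \<infinity>"
    using f Lip_mono[of K UNIV f d] unfolding Lip_b_def by (auto intro: le_less_trans)
  then obtain r where r: "0 \<le> r" "Lip f K d = ennreal r"
    by (cases "Lip f K d") auto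
  define e where "e = (\<lambda>n. inverse (real (Suc n)))"
  have e: "0 < e n" for n
    by (simp add: e_def)
  \<comment> \<open>One \<open>e n\<close> makes the Lipschitz constant \<open>r + e n\<close>
    positive even when \<open>r = 0\<close>; the other is the error from cutting \<open>K\<close>
    into pieces.\<close>
  have "AE x in M. \<forall>n. x \<in> K \<longrightarrow> ennreal \<bar>b f x\<bar> \<le> ennreal (g x) * ennreal (r + e n + e n)"
    unfolding AE_all_countable
    by (intro allI derivation_le_on_compact_approx[OF emts b bound K f])
      (use r e in \<open>auto intro: add_nonneg_pos less_imp_le intro!: ennreal_leI\<close>)
  then show ?thesis
  proof eventually_elim
    case (elim x)
    have "e \<longlonglongrightarrow> 0"
      unfolding e_def by (rule LIMSEQ_inverse_real_of_nat)
    then have "(\<lambda>n. r + e n + e n) \<longlonglongrightarrow> r + 0 + 0"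
      by (intro tendsto_intros)
    \<comment> \<open>The factor \<open>ennreal (g x)\<close> is finite, so multiplication by it
      commutes with the limit.\<close>
    then have "(\<lambda>n. ennreal (g x) * ennreal (r + e n + e n)) \<longlonglongrightarrow> ennreal (g x) * ennreal r"
      by (intro ennreal_tendsto_cmult tendsto_ennrealI) auto
    then show ?case
      using elim unfolding r(2) by (auto intro: LIMSEQ_le_const)
  qed
qed

section \<open>Passing from compact sets to Borel sets and to sets varying with the point\<close>

text \<open>The supremum in inner regularity is reached along a sequence of compact subsets of
  \<open>B\<close>. Their union fills \<open>B\<close> up to a null set, and only countably many
  exceptional sets have to be merged.\<close>

lemma AE_by_compact_subsets:
  assumes M: "finite_Radon_measure M" and B: "B \<in> sets M"
    and P: "\<And>K. compact K \<Longrightarrow> K \<subseteq> B \<Longrightarrow> AE x in M. x \<in> K \<longrightarrow> P x"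
  shows "AE x in M. (x :: 'a::t2_space) \<in> B \<longrightarrow> P x"
proof -
  interpret finite_measure M
    using M unfolding finite_Radon_measure_def by blast
  have sets: "K \<in> sets M" if "compact K" for K
    using M compact_imp_closed[OF that] unfolding finite_Radon_measure_def by auto
  define \<K> where "\<K> = {K. compact K \<and> K \<subseteq> B}"
  have "{} \<in> \<K>"
    by (simp add: \<K>_def)
  then obtain m where m: "range m \<subseteq> emeasure M ` \<K>" "(SUP K\<in>\<K>. emeasure M K) = (SUP n::nat. m n)"
    using ennreal_SUP_countable_SUP[of \<K> "emeasure M"] by blast
  then have "\<forall>n. \<exists>K\<in>\<K>. m n = emeasure M K"
    by blast
  then obtain K where K: "\<And>n. K n \<in> \<K>" "\<And>n. m n = emeasure M (K n)"
    by metis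
  have K_sets: "K n \<in> sets M" and KB: "K n \<subseteq> B" for n
    using K(1)[of n] sets by (auto simp: \<K>_def)
  define N where "N = B - (\<Union>n. K n)"
  have "emeasure M B = (SUP n. emeasure M (K n))"
    using M B m(2) K(2) unfolding finite_Radon_measure_def \<K>_def by auto
  also have "\<dots> \<le> emeasure M (\<Union>n. K n)"
    using K_sets by (intro SUP_least emeasure_mono) auto
  \<comment> \<open>Finiteness of the measure allows the subtraction that turns this inequality into
    nullity of the difference.\<close>
  finally have "emeasure M N = 0"
    unfolding N_def using B K_sets KB
    by (subst emeasure_Diff) (auto simp: diff_eq_0_iff_ennreal less_top[symmetric])
  then have "AE x in M. x \<notin> N"
    using B K_sets unfolding N_def by (intro AE_not_in null_setsI) auto
  moreover have "AE x in M. \<forall>n. x \<in> K n \<longrightarrow> P x"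
    unfolding AE_all_countable using K(1) P unfolding \<K>_def by blast
  ultimately show ?thesis
    by eventually_elim (auto simp: N_def)
qed

lemma derivation_le_on_Borel:
  fixes d :: "'a::t2_space \<Rightarrow> 'a \<Rightarrow> ennreal"
  assumes X: "extended_metric_topological_measure_space d M"
    and b: "local_Lipschitz_derivation d M b"
    and bound: "\<And>f. f \<in> Lip_b d \<Longrightarrow> AE x in M. ennreal \<bar>b f x\<bar> \<le> ennreal (g x) * Lip_b_norm d f"
    and B: "B \<in> sets M" and f: "f \<in> Lip_b d"
  shows "AE x in M. x \<in> B \<longrightarrow> ennreal \<bar>b f x\<bar> \<le> ennreal (g x) * Lip f B d"
proof (rule AE_by_compact_subsets[OF _ B])
  fix K assume K: "compact K" "K \<subseteq> B"
  have "AE x in M. x \<in> K \<longrightarrow> ennreal \<bar>b f x\<bar> \<le> ennreal (g x) * Lip f K d"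
    using X by (intro derivation_le_on_compact[OF _ b bound K(1) f])
      (auto simp: extended_metric_topological_measure_space_def)
  then show "AE x in M. x \<in> K \<longrightarrow> ennreal \<bar>b f x\<bar> \<le> ennreal (g x) * Lip f B d"
    by eventually_elim (meson Lip_mono[OF K(2)] mult_left_mono order_trans zero_le)
qed (use X in \<open>simp add: extended_metric_topological_measure_space_def\<close>)

text \<open>Both claims bound \<open>b f\<close> at \<open>x\<close> by a Lipschitz constant over a
  set \<open>N x\<close> that moves with \<open>x\<close>, so the estimate for a fixed Borel set
  does not apply directly. A compact part of \<open>C\<close> is covered by finitely many
  \<open>W z\<close>; the estimate holds on each fixed \<open>C \<inter> W z\<close>, and this set
  lies in \<open>N x\<close> for every \<open>x\<close> in it.\<close>

lemma derivation_le_on_neighbourhoods: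
  fixes d :: "'a::t2_space \<Rightarrow> 'a \<Rightarrow> ennreal"
  assumes X: "extended_metric_topological_measure_space d M"
    and b: "local_Lipschitz_derivation d M b"
    and bound: "\<And>f. f \<in> Lip_b d \<Longrightarrow> AE x in M. ennreal \<bar>b f x\<bar> \<le> ennreal (g x) * Lip_b_norm d f"
    and C: "closed C" and f: "f \<in> Lip_b d"
    and N: "\<And>z. z \<in> C \<Longrightarrow> \<exists>W. open W \<and> z \<in> W \<and> (\<forall>x\<in>C \<inter> W. C \<inter> W \<subseteq> N x)"
  shows "AE x in M. x \<in> C \<longrightarrow> ennreal \<bar>b f x\<bar> \<le> ennreal (g x) * Lip f (N x) d"
proof (rule AE_by_compact_subsets)
  show M: "finite_Radon_measure M"
    using X by (simp add: extended_metric_topological_measure_space_def)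
  then have borel: "A \<in> sets borel \<Longrightarrow> A \<in> sets M" for A
    by (simp add: finite_Radon_measure_def)
  then show "C \<in> sets M"
    using C by auto
  fix K assume K: "compact K" "K \<subseteq> C"
  obtain W where W: "\<And>z. z \<in> C \<Longrightarrow> open (W z)" "\<And>z. z \<in> C \<Longrightarrow> z \<in> W z"
    "\<And>z x. z \<in> C \<Longrightarrow> x \<in> C \<inter> W z \<Longrightarrow> C \<inter> W z \<subseteq> N x"
    using N by metis
  obtain I where I: "I \<subseteq> K" "finite I" "K \<subseteq> (\<Union>z\<in>I. W z)"
  proof (rule compactE_image[OF K(1), of K W])
    show "open (W z)" if "z \<in> K" for z
      using that W(1) K(2) by blast
    show "K \<subseteq> (\<Union>z\<in>K. W z)"
      using W(2) K(2) by blast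
  qed
  have "AE x in M. \<forall>z\<in>I. x \<in> C \<inter> W z \<longrightarrow> ennreal \<bar>b f x\<bar> \<le> ennreal (g x) * Lip f (C \<inter> W z) d"
  proof (intro AE_finite_allI I derivation_le_on_Borel[OF X b bound _ f])
    show "C \<inter> W z \<in> sets M" if "z \<in> I" for z
      using that I(1) K(2) W(1) C by (intro borel sets.Int borel_closed borel_open) auto
  qed
  then show "AE x in M. x \<in> K \<longrightarrow> ennreal \<bar>b f x\<bar> \<le> ennreal (g x) * Lip f (N x) d"
  proof eventually_elim
    case (elim x)
    show ?case
    proof
      assume "x \<in> K"
      then obtain z where z: "z \<in> I" "x \<in> W z"
        using I(3) by blast
      have "x \<in> C" "z \<in> C"
        using \<open>x \<in> K\<close> z(1) I(1) K(2) by auto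
      then have "ennreal \<bar>b f x\<bar> \<le> ennreal (g x) * Lip f (C \<inter> W z) d"
        using elim z by blast
      also have "\<dots> \<le> ennreal (g x) * Lip f (N x) d"
        using W(3)[of z x] z \<open>x \<in> C\<close> \<open>z \<in> C\<close> by (intro mult_left_mono Lip_mono) auto
      finally show "ennreal \<bar>b f x\<bar> \<le> ennreal (g x) * Lip f (N x) d" .
    qed
  qed
qed

section \<open>Entourages, infima, and the two claims\<close>

text \<open>Every generating entourage contains the diagonal, so the principal filter at
  \<open>(x, x)\<close> lies below the uniformity.\<close>

lemma refl_of_canonical_uniformity:
  assumes "eventually (\<lambda>p. p \<in> U) (canonical_uniformity d)"
  shows "(x, x) \<in> U"
proof -
  have "principal {(x, x)} \<le> canonical_uniformity d"
    unfolding canonical_uniformity_def by (intro INF_greatest) auto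
  then have "eventually (\<lambda>p. p \<in> U) (principal {(x, x)})"
    using assms by (rule filter_leD)
  then show ?thesis
    by (simp add: eventually_principal)
qed

text \<open>A positive finite factor can be divided out. If \<open>c \<le> 0\<close>, the factor is
  0 in \<open>ennreal\<close>, and any single index already gives \<open>a = 0\<close>; this is
  where \<open>I\<close> must be nonempty.\<close>

lemma le_cmult_INF_ennreal:
  assumes "I \<noteq> {}" "\<And>i. i \<in> I \<Longrightarrow> a \<le> ennreal c * u i"
  shows "a \<le> ennreal c * (INF i\<in>I. u i)"
proof (cases "0 < c")
  case True
  have "a / ennreal c \<le> (INF i\<in>I. u i)"
    using assms True by (intro INF_greatest divide_le_posI_ennreal) (auto simp: mult.commute)
  then have "ennreal c * (a / ennreal c) \<le> ennreal c * (INF i\<in>I. u i)"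
    by (intro mult_left_mono) auto
  moreover have "ennreal c * (a / ennreal c) = a"
    using True by (simp add: ennreal_times_divide mult.commute mult_divide_eq_ennreal)
  ultimately show ?thesis
    by simp
next
  case False
  then show ?thesis
    using assms by (auto simp: ennreal_neg)
qed

theorem proposition4p15:
  fixes d :: "'a::t2_space \<Rightarrow> 'a \<Rightarrow> ennreal"
    and M :: "'a measure"
    and b :: "('a \<Rightarrow> real) \<Rightarrow> ('a \<Rightarrow> real)"
    and g :: "'a \<Rightarrow> real"
    and C :: "'a set"
  assumes "extended_metric_topological_measure_space d M"
    and "local_Lipschitz_derivation d M b"
    and "g \<in> borel_measurable M"
    and "AE x in M. 0 \<le> g x"
    and "\<And>f. f \<in> Lip_b d \<Longrightarrow> AE x in M. ennreal \<bar>b f x\<bar> \<le> ennreal (g x) * Lip_b_norm d f"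
    and "closed C"
  shows "(\<forall>U\<in>open_sym_entourages d. \<forall>f\<in>Lip_b d.
            AE x in M. x \<in> C \<longrightarrow> ennreal \<bar>b f x\<bar> \<le> ennreal (g x) * Lip f (C \<inter> U `` {x}) d) \<and>
         (metrizable_space (top_of_set C) \<longrightarrow>
            (\<forall>f\<in>Lip_b d.
               AE x in M. x \<in> C \<longrightarrow> ennreal \<bar>b f x\<bar> \<le> ennreal (g x) * asymptotic_slope_on d C f x))"
proof (intro conjI ballI impI)
  fix U f assume U: "U \<in> open_sym_entourages d" and f: "f \<in> Lip_b d"
  show "AE x in M. x \<in> C \<longrightarrow> ennreal \<bar>b f x\<bar> \<le> ennreal (g x) * Lip f (C \<inter> U `` {x}) d"
  proof (rule derivation_le_on_neighbourhoods[OF assms(1,2,5,6) f])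
    fix z
    have "open U" "(z, z) \<in> U"
      using U by (auto simp: open_sym_entourages_def intro: refl_of_canonical_uniformity)
    then obtain A B where "open A" "open B" "(z, z) \<in> A \<times> B" "A \<times> B \<subseteq> U"
      by (rule open_prod_elim)
    \<comment> \<open>With \<open>W = A \<inter> B\<close>, the square of \<open>W\<close> lies in
      \<open>U\<close>, so any two points of \<open>W\<close> are \<open>U\<close>-close.\<close>
    then show "\<exists>W. open W \<and> z \<in> W \<and> (\<forall>x\<in>C \<inter> W. C \<inter> W \<subseteq> C \<inter> U `` {x})"
      by (intro exI[of _ "A \<inter> B"]) auto
  qed
next
  fix f assume metr: "metrizable_space (top_of_set C)" and f: "f \<in> Lip_b d"
  obtain S \<rho> where "Metric_space S \<rho>" and top: "top_of_set C = Metric_space.mtopology S \<rho>"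
    using metr unfolding metrizable_space_def by blast
  interpret Metric_space S \<rho> by fact
  have S: "S = C"
    using arg_cong[OF top, of topspace] by simp
  define r where "r = (\<lambda>n. inverse (real (Suc n)))"
  have r: "0 < r n" for n
    by (simp add: r_def)
  \<comment> \<open>The slope is an infimum over a possibly uncountable family of neighbourhoods.
    Balls of radius \<open>r n\<close> for a metric inducing the topology of \<open>C\<close> form a
    countable substitute, so a single null set serves all of them.\<close>
  have "AE x in M. \<forall>n. x \<in> C \<longrightarrow> ennreal \<bar>b f x\<bar> \<le> ennreal (g x) * Lip f (mball x (r n)) d"
    unfolding AE_all_countable
  proof (rule allI, rule derivation_le_on_neighbourhoods[OF assms(1,2,5,6) f])
    fix n z assume z: "z \<in> C"
    \<comment> \<open>Half the radius is taken because any two points of this ball are then at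
      distance less than \<open>r n\<close>.\<close>
    have "openin (top_of_set C) (mball z (r n / 2))"
      unfolding top by simp
    then obtain W where W: "open W" "mball z (r n / 2) = C \<inter> W"
      by (auto simp: openin_open)
    have "z \<in> W"
      using W(2) z r[of n] S by (metis Int_iff centre_in_mball_iff half_gt_zero)
    moreover have "mball z (r n / 2) \<subseteq> mball x (r n)" if x: "x \<in> mball z (r n / 2)" for x
    proof
      fix y assume "y \<in> mball z (r n / 2)"
      with x show "y \<in> mball x (r n)"
        using triangle[of x z y] commute[of x z] by auto
    qed
    ultimately show "\<exists>W. open W \<and> z \<in> W \<and> (\<forall>x\<in>C \<inter> W. C \<inter> W \<subseteq> mball x (r n))"
      using W by metis
  qed
  then show "AE x in M. x \<in> C \<longrightarrow> ennreal \<bar>b f x\<bar> \<le> ennreal (g x) * asymptotic_slope_on d C f x"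
  proof eventually_elim
    case (elim x)
    show ?case
      unfolding asymptotic_slope_on_def
    proof (intro impI le_cmult_INF_ennreal)
      fix U assume x: "x \<in> C" and U: "U \<in> {U. open U \<and> x \<in> U}"
      then have "openin mtopology (C \<inter> U)"
        unfolding top[symmetric] by (auto simp: openin_open)
      then obtain \<epsilon> where \<epsilon>: "0 < \<epsilon>" "mball x \<epsilon> \<subseteq> C \<inter> U"
        using x U unfolding openin_mtopology by blast
      \<comment> \<open>Every neighbourhood of \<open>x\<close> in \<open>C\<close> contains one of
        the chosen balls, so monotonicity of \<open>Lip\<close> carries the bound over.\<close>
      obtain n where "r n < \<epsilon>"
        unfolding r_def using reals_Archimedean[OF \<epsilon>(1)] by blast
      then have "mball x (r n) \<subseteq> U \<inter> C"
        using \<epsilon>(2) mball_subset_concentric[of "r n" \<epsilon> x] by auto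
      have "ennreal \<bar>b f x\<bar> \<le> ennreal (g x) * Lip f (mball x (r n)) d"
        using elim x by blast
      also have "\<dots> \<le> ennreal (g x) * Lip f (U \<inter> C) d"
        by (intro mult_left_mono Lip_mono) (fact, simp)
      finally show "ennreal \<bar>b f x\<bar> \<le> ennreal (g x) * Lip f (U \<inter> C) d" .
    qed auto
  qed
qed

end
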